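(* Let $V$ be a vertex set with $|V|=n\ge 2$ and let $G$ be the disjoint union of $n-1$ spanning arborescences $A_1,\dots,A_{n-1}$ on $V$. If the underlying undirected graph of $G$ is a tree (equivalently, there is a tree $T$ on $V$ such that every $A_i$ is an orientation of $T$), then $G$ has a rainbow spanning arborescence.
   Context: An arborescence is a connected digraph in which exactly one vertex (the root) has no incoming arc and every other vertex has exactly one incoming arc; it is spanning on $V$ if its vertex set is $V$. $G$ is the disjoint union of the arc sets $A_i$ (parallel arcs of different indices allowed); its underlying graph is obtained by ignoring orientations and identifying parallel edges. A subgraph $B$ of $G$ is rainbow if $|B\cap A_i|\le 1$ for all $i$. *)

theory Defs
  imports "Graph_Theory.Digraph_Component" "HOL-Library.Disjoint_Sets"
begin

text \<open>
  Here \<open>connected\<close> is the library's notion, i.e. connectedness of the underlying undirected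
  graph.
\<close>

definition arborescence :: "('a, 'b) pre_digraph \<Rightarrow> bool" where
  "arborescence D \<longleftrightarrow> wf_digraph D \<and> connected D \<and>
     (\<exists>r \<in> verts D. in_arcs D r = {} \<and> (\<forall>v \<in> verts D - {r}. in_degree D v = 1))"

definition spanning_arborescence :: "('a, 'b) pre_digraph \<Rightarrow> ('a, 'b) pre_digraph \<Rightarrow> bool" where
  "spanning_arborescence H G \<longleftrightarrow> arborescence H \<and> spanning H G"

text \<open>
  The underlying undirected graph of \<open>G\<close> is represented by \<open>mk_symmetric G\<close>, in which every
  undirected edge becomes a pair of opposite arcs and parallel arcs are identified. Going back
  and forth along one edge is a \<open>cycle\<close> of length 2 there; it is the only kind of
  cycle that does not come from a cycle of the undirected graph (loops give length 1).
  The library constants \<open>forest\<close> and \<open>tree\<close> are unsuitable because they do not make this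
  exception and refer to directed cycles only.
\<close>

definition underlying_tree :: "('a, 'b) pre_digraph \<Rightarrow> bool" where
  "underlying_tree G \<longleftrightarrow> wf_digraph G \<and> connected G \<and>
     \<not> (\<exists>p. pre_digraph.cycle (with_proj (mk_symmetric G)) p \<and> length p \<noteq> 2)"

definition rainbow :: "'i set \<Rightarrow> ('i \<Rightarrow> ('a, 'b) pre_digraph) \<Rightarrow> ('a, 'b) pre_digraph \<Rightarrow> bool" where
  "rainbow I A B \<longleftrightarrow> (\<forall>i \<in> I. card (arcs B \<inter> arcs (A i)) \<le> 1)"

end

theory Submission
  imports Defs
begin

text \<open>
  The first arborescence identifies the edges of \<open>T\<close> with the non-root vertices \<open>v\<close>, the edge being
  \<open>{v, par v}\<close>. As \<open>T\<close> has no cycles, every \<open>A\<^sub>i\<close> contains an arc on each of these edges, and its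
  head map \<open>h\<^sub>i\<close> is injective because in-degrees are at most one. Conversely, \<open>n - 1\<close> arcs, one on
  each edge, form a spanning arborescence as soon as their heads are distinct. So it suffices to
  distribute the indices over the edges such that \<open>v \<mapsto> h\<^bsub>\<sigma> v\<^esub> v\<close> is injective, which is done by removing
  leaves: if some \<open>h\<^sub>i\<close> points to the leaf, that index serves the leaf edge; otherwise all of them
  point to its neighbour \<open>p\<close>, and then no \<open>h\<^sub>i\<close> sends a remaining edge to \<open>p\<close>, so that any index
  serves the leaf edge.
\<close>

text \<open>The depth \<open>d\<close> rules out cycles of \<open>par\<close>, so every nonempty
  finite subset of \<open>S\<close> has a leaf. Since \<open>par v\<close> may lie outside
  \<open>S\<close>, the hypotheses pass to subsets and the root needs no index.\<close>

lemma rainbow_inj_choice: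
  fixes par :: "'a \<Rightarrow> 'a" and d :: "'a \<Rightarrow> nat" and h :: "'i \<Rightarrow> 'a \<Rightarrow> 'a"
  assumes "finite S" "finite I" "card I = card S"
    and "\<And>v. v \<in> S \<Longrightarrow> d (par v) < d v"
    and "\<And>i v. i \<in> I \<Longrightarrow> v \<in> S \<Longrightarrow> h i v \<in> {v, par v}"
    and "\<And>i. i \<in> I \<Longrightarrow> inj_on (h i) S"
  shows "\<exists>\<sigma>. bij_betw \<sigma> S I \<and> inj_on (\<lambda>v. h (\<sigma> v) v) S"
  using assms
proof (induction "card S" arbitrary: S I)
  case 0
  then show ?case by (auto simp: bij_betw_def)
next
  case (Suc m)
  note d = Suc.prems(4) and h = Suc.prems(5) and inj = Suc.prems(6)
  have "S \<noteq> {}" using Suc.hyps(2) by auto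
  \<comment> \<open>An element of maximal depth is nobody's parent, since a child would lie
    deeper.\<close>
  then obtain l where l: "l \<in> S" and "\<And>v. v \<in> S \<Longrightarrow> d v \<le> d l"
    using finite_has_maximal[of "d ` S"] Suc.prems(1)
    by (metis (no_types, lifting) Max_ge Max_in finite_imageI image_iff image_is_empty)
  then have leaf: "par v \<noteq> l" if "v \<in> S" for v
    using d[OF that] that by force
  have "I \<noteq> {}" using Suc.hyps(2) Suc.prems(3) by auto
  then obtain i where i: "i \<in> I" and ch: "h i l = l \<or> (\<forall>j\<in>I. h j l \<noteq> l)"
    by blast
  have "\<exists>\<sigma>. bij_betw \<sigma> (S - {l}) (I - {i}) \<and> inj_on (\<lambda>v. h (\<sigma> v) v) (S - {l})"
    using Suc.hyps(2) Suc.prems(1,2,3) i l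
    by (intro Suc.hyps(1)) (auto intro: d inj_on_subset[OF inj] dest: h)
  then obtain \<sigma> where bij: "bij_betw \<sigma> (S - {l}) (I - {i})"
    and inj': "inj_on (\<lambda>v. h (\<sigma> v) v) (S - {l})" by blast
  \<comment> \<open>If \<open>h i l = l\<close>, the other heads lie in \<open>{v, par v}\<close>,
    which avoids the leaf. Otherwise all indices agree at \<open>l\<close>, and injectivity of the
    single map \<open>h (\<sigma> v)\<close> separates \<open>v\<close> from
    \<open>l\<close>.\<close>
  have new: "h (\<sigma> v) v \<noteq> h i l" if v: "v \<in> S - {l}" for v
  proof -
    have j: "\<sigma> v \<in> I" using bij v by (auto simp: bij_betw_def)
    show ?thesis using ch
    proof
      assume "h i l = l"
      then show ?thesis using h[OF j, of v] leaf[of v] v by auto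
    next
      assume "\<forall>j\<in>I. h j l \<noteq> l"
      then have "h i l = h (\<sigma> v) l" using h[OF i l] h[OF j l] i j by auto
      then show ?thesis using inj_onD[OF inj[OF j], of v l] v l by auto
    qed
  qed
  let ?\<sigma> = "\<sigma>(l := i)"
  have "bij_betw ?\<sigma> (S - {l}) (I - {i})"
    using bij by (rule bij_betw_cong[THEN iffD1, rotated]) simp
  then have "bij_betw ?\<sigma> (S - {l} \<union> {l}) (I - {i} \<union> {?\<sigma> l})"
    using notIn_Un_bij_betw3[of l "S - {l}" ?\<sigma> "I - {i}"] by simp
  moreover have "S - {l} \<union> {l} = S" "I - {i} \<union> {?\<sigma> l} = I" using l i by auto
  moreover have "inj_on (\<lambda>v. h (?\<sigma> v) v) S"
    using inj' new by (auto simp: inj_on_def) metis+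
  ultimately show ?case by metis
qed

lemma arborescence_head_inj:
  assumes "arborescence D"
  shows "inj_on (head D) (arcs D)"
proof (rule inj_onI)
  fix a b assume ab: "a \<in> arcs D" "b \<in> arcs D" "head D a = head D b"
  obtain r where wf: "wf_digraph D" and r: "in_arcs D r = {}"
    and deg: "\<And>v. v \<in> verts D - {r} \<Longrightarrow> in_degree D v = 1"
    using assms unfolding arborescence_def by blast
  have "head D a \<in> verts D - {r}" using wf_digraph.head_in_verts[OF wf ab(1)] r ab(1) by auto
  from deg[OF this] obtain c where "in_arcs D (head D a) = {c}"
    by (auto simp: in_degree_def card_1_singleton_iff)
  moreover have "a \<in> in_arcs D (head D a)" "b \<in> in_arcs D (head D a)" using ab by auto
  ultimately show "a = b" by (metis singletonD)
qed

lemma connected_reachable: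
  assumes "connected D" "u \<in> verts D" "v \<in> verts D"
  shows "u \<rightarrow>\<^sup>*\<^bsub>with_proj (mk_symmetric D)\<^esub> v"
  using assms unfolding connected_def strongly_connected_def by simp

text \<open>Take for \<open>d\<close> the directed distance from the root and for
  \<open>par v\<close> the predecessor of \<open>v\<close> on a shortest directed walk. What needs
  proof is that connectedness, which ignores orientations, gives directed reachability from the
  root.\<close>

lemma arborescence_depth:
  fixes D :: "('a, 'b) pre_digraph"
  assumes "arborescence D"
  shows "\<exists>r\<in>verts D. \<exists>par. \<exists>d :: 'a \<Rightarrow> nat. \<forall>v\<in>verts D - {r}.
    (par v, v) \<in> arcs_ends D \<and> d (par v) < d v"
proof -
  obtain r where wf: "wf_digraph D" and con: "connected D" and r: "r \<in> verts D" "in_arcs D r = {}"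
    and deg: "\<And>v. v \<in> verts D - {r} \<Longrightarrow> in_degree D v = 1"
    using assms unfolding arborescence_def by blast
  let ?R = "arcs_ends D"
  define d where "d v = (LEAST k. (r, v) \<in> ?R ^^ k)" for v
  have root: "(u, r) \<notin> ?R" for u using r(2) by (auto simp: arcs_ends_conv in_arcs_def)
  have uniq: "u = w" if "(u, v) \<in> ?R" "(w, v) \<in> ?R" for u v w
    using that arborescence_head_inj[OF assms] by (auto simp: arcs_ends_conv inj_on_def)
  have reach: "(r, v) \<in> ?R\<^sup>*" if "v \<in> verts D" for v
  proof -
    have "(r, v) \<in> (arcs_ends (with_proj (mk_symmetric D)))\<^sup>*"
      using connected_reachable[OF con r(1) that] by (rule reachable_rtranclI)
    then show ?thesis
    proof induction
      case (step u w)
      then have "(u, w) \<in> ?R \<or> (w, u) \<in> ?R"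
        by (auto simp: arcs_ends_conv parcs_mk_symmetric)
      \<comment> \<open>A step along an arc extends the directed walk. For a step against an arc
        \<open>(w, u)\<close>, the walk to \<open>u\<close> is nonempty and its last arc starts in
        \<open>w\<close> by \<open>uniq\<close>; dropping that arc leaves a walk to
        \<open>w\<close>.\<close>
      then show ?case
      proof
        assume wu: "(w, u) \<in> ?R"
        then have "u \<noteq> r" using root by auto
        then obtain x where "(r, x) \<in> ?R\<^sup>*" "(x, u) \<in> ?R"
          using step.IH by (metis rtranclE)
        then show ?thesis using uniq[OF wu] by blast
      qed (use step.IH in auto)
    qed simp
  qed
  have pred: "\<exists>u. (u, v) \<in> ?R \<and> d u < d v" if v: "v \<in> verts D - {r}" for v
  proof -
    have "\<exists>k. (r, v) \<in> ?R ^^ k" using reach[of v] v by (auto simp: rtrancl_power)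
    then have k: "(r, v) \<in> ?R ^^ d v" unfolding d_def by (rule LeastI_ex)
    then obtain m where m: "d v = Suc m" using v by (cases "d v") auto
    then obtain u where "(r, u) \<in> ?R ^^ m" "(u, v) \<in> ?R" using k by auto
    moreover have "d u \<le> m" unfolding d_def by (rule Least_le) fact
    ultimately show ?thesis using m by auto
  qed
  then have "\<exists>par. \<forall>v\<in>verts D - {r}. (par v, v) \<in> ?R \<and> d (par v) < d v"
    by (intro bchoice) blast
  then show ?thesis using r(1) by blast
qed

text \<open>A path in \<open>H\<close> between the ends of an edge of \<open>G\<close> has length 1, or else it would close to a
  cycle with that edge.\<close>
lemma underlying_tree_connected_subgraph_edge:
  assumes tree: "underlying_tree G" and sub: "subgraph H G" and con: "connected H"
    and uv: "u \<in> verts H" "v \<in> verts H" "u \<noteq> v" "(v, u) \<in> parcs (mk_symmetric G)"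
  shows "(u, v) \<in> parcs (mk_symmetric H)"
proof -
  let ?G = "with_proj (mk_symmetric G)" and ?H = "with_proj (mk_symmetric H)"
  have wf: "wf_digraph G" "wf_digraph H" using sub by (auto simp: subgraph_def)
  interpret G: pair_wf_digraph "mk_symmetric G"
    using wf(1) by (rule wf_digraph.wellformed_mk_symmetric)
  interpret H: pair_wf_digraph "mk_symmetric H"
    using wf(2) by (rule wf_digraph.wellformed_mk_symmetric)
  have "u \<rightarrow>\<^sup>*\<^bsub>?H\<^esub> v" using connected_reachable[OF con uv(1,2)] .
  then obtain p where p: "H.apath u p v" using H.reachable_apath by blast
  have par: "parcs (mk_symmetric H) \<subseteq> parcs (mk_symmetric G)"
    using sub by (fastforce simp: subgraph_def compatible_def parcs_mk_symmetric)
  have comp: "compatible ?H ?G" by auto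
  have walk: "G.awalk u p v" and dist: "distinct (pawalk_verts u p)"
    using p par sub compatible_cas[OF comp] compatible_awalk_verts[OF comp]
    by (auto simp: H.apath_def H.awalk_def G.awalk_def subgraph_def)
  have ne: "p \<noteq> []" using p uv(3) H.apath_Nil_iff by auto
  have last: "last (pawalk_verts u p) = v" using walk by auto
  let ?c = "p @ [(v, u)]"
  have cw: "G.awalk u ?c u"
    using walk last uv(4) by (auto simp: G.awalk_Cons_iff G.awalk_Nil_iff)
  have "pawalk_verts u ?c = pawalk_verts u p @ [u]"
    using G.awalk_verts_append[OF cw] by simp
  moreover have "hd (pawalk_verts u p) = u" using walk by (rule G.awhd_of_awalk)
  ultimately have "distinct (tl (pawalk_verts u ?c))"
    using dist by (cases "pawalk_verts u p") auto
  then have "G.cycle ?c" using cw unfolding G.cycle_def by blast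
  \<comment> \<open>Only cycles of length 2 are tolerated, so \<open>p\<close> is a single arc, and
    it belongs to the symmetric closure of \<open>H\<close>.\<close>
  then have "length ?c = 2" using tree unfolding underlying_tree_def by blast
  then obtain e where "p = [e]" by (auto simp: length_Suc_conv numeral_2_eq_2)
  then show ?thesis
    using p by (cases e) (auto simp: H.apath_def H.awalk_def)
qed

theorem theorem3p7:
  fixes G :: "('a, 'b) pre_digraph"
    and A :: "nat \<Rightarrow> ('a, 'b) pre_digraph"
    and n :: nat
  assumes "card (verts G) = n" and "n \<ge> 2"
    and "\<And>i. i \<in> {1..n - 1} \<Longrightarrow> spanning_arborescence (A i) G"
    and "disjoint_family_on (\<lambda>i. arcs (A i)) {1..n - 1}"
    and "arcs G = (\<Union>i \<in> {1..n - 1}. arcs (A i))"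
    and "underlying_tree G"
  shows "\<exists>B. spanning_arborescence B G \<and> rainbow {1..n - 1} A B"
proof -
  let ?I = "{1..n - 1}"
  have finV: "finite (verts G)" using assms(1,2) by (intro card_ge_0_finite) auto
  have wf: "wf_digraph G" using assms(6) by (simp add: underlying_tree_def)
  have arb: "arborescence (A i)" and sub: "subgraph (A i) G" and vA: "verts (A i) = verts G"
    and tA: "tail (A i) = tail G" and hA: "head (A i) = head G" if "i \<in> ?I" for i
    using assms(3)[OF that]
    by (auto simp: spanning_arborescence_def spanning_def subgraph_def compatible_def)
  have one: "1 \<in> ?I" using assms(2) by auto
  obtain r and par :: "'a \<Rightarrow> 'a" and d :: "'a \<Rightarrow> nat" where r: "r \<in> verts G"
    and pd: "\<forall>v\<in>verts G - {r}. (par v, v) \<in> arcs_ends (A 1) \<and> d (par v) < d v"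
    using arborescence_depth[OF arb[OF one]] unfolding vA[OF one] by (elim bexE exE)
  have par': "(par v, v) \<in> arcs_ends (A 1)" and d: "d (par v) < d v" if "v \<in> verts G - {r}" for v
    using bspec[OF pd that] by simp_all
  have par: "(par v, v) \<in> arcs_ends G" if "v \<in> verts G - {r}" for v
    using par'[OF that] arcs_ends_mono[OF sub[OF one]] by auto
  have parV: "par v \<in> verts G" if "v \<in> verts G - {r}" for v
    using par[OF that] wf_digraph.adj_in_verts(1)[OF wf] by blast
  define S where "S = verts G - {r}"
  have cardS: "card S = n - 1" using r finV assms(1) by (simp add: S_def)
  have finS: "finite S" using finV by (simp add: S_def)
  have "\<exists>a\<in>arcs (A i). {tail G a, head G a} = {v, par v}" if i: "i \<in> ?I" and v: "v \<in> S" for i v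
  proof -
    have v': "v \<in> verts G - {r}" using v by (simp add: S_def)
    have "v \<noteq> par v" using d[OF v'] by auto
    moreover have "(par v, v) \<in> parcs (mk_symmetric G)"
      using par[OF v'] by (auto simp: parcs_mk_symmetric arcs_ends_conv)
    ultimately have "(v, par v) \<in> parcs (mk_symmetric (A i))"
      using underlying_tree_connected_subgraph_edge[OF assms(6) sub[OF i], of v "par v"]
        arb[OF i] parV[OF v'] v' vA[OF i] by (auto simp: arborescence_def)
    then show ?thesis by (auto simp: parcs_mk_symmetric tA[OF i] hA[OF i])
  qed
  then obtain a where a: "\<And>i v. i \<in> ?I \<Longrightarrow> v \<in> S \<Longrightarrow> a i v \<in> arcs (A i)"
    and ends: "\<And>i v. i \<in> ?I \<Longrightarrow> v \<in> S \<Longrightarrow> {tail G (a i v), head G (a i v)} = {v, par v}"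
    by metis
  \<comment> \<open>Equal heads force equal arcs, hence equal edges. Distinct \<open>u\<close> and
    \<open>v\<close> with the same edge would be each other's parents, which the depth
    forbids.\<close>
  have inj: "inj_on (\<lambda>v. head G (a i v)) S" if i: "i \<in> ?I" for i
  proof (rule inj_onI)
    fix u v assume uv: "u \<in> S" "v \<in> S" "head G (a i u) = head G (a i v)"
    then have "a i u = a i v"
      using arborescence_head_inj[OF arb[OF i]] a[OF i] hA[OF i] by (auto simp: inj_on_def)
    then have "{u, par u} = {v, par v}" using ends[OF i] uv(1,2) by metis
    then show "u = v" using d[of u] d[of v] uv(1,2)
      by (auto simp: S_def doubleton_eq_iff)
  qed
  have "\<exists>\<sigma>. bij_betw \<sigma> S ?I \<and> inj_on (\<lambda>v. head G (a (\<sigma> v) v)) S"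
  proof (rule rainbow_inj_choice[where par = par and d = d and h = "\<lambda>i v. head G (a i v)"])
    show "head G (a i v) \<in> {v, par v}" if "i \<in> ?I" "v \<in> S" for i v using ends[OF that] by blast
  qed (use finS cardS d inj in \<open>auto simp: S_def\<close>)
  then obtain \<sigma> where bij: "bij_betw \<sigma> S ?I" and injh: "inj_on (\<lambda>v. head G (a (\<sigma> v) v)) S"
    by blast
  have \<sigma>: "\<sigma> v \<in> ?I" if "v \<in> S" for v using bij that by (auto simp: bij_betw_def)
  define b where "b v = a (\<sigma> v) v" for v
  have bA: "b v \<in> arcs (A (\<sigma> v))" if "v \<in> S" for v using a[OF \<sigma>[OF that] that] by (simp add: b_def)
  have bends: "{tail G (b v), head G (b v)} = {v, par v}" if "v \<in> S" for v
    using ends[OF \<sigma>[OF that] that] by (simp add: b_def)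
  have bG: "b v \<in> arcs G" if "v \<in> S" for v using bA[OF that] \<sigma>[OF that] assms(5) by blast
  have injb: "inj_on (\<lambda>v. head G (b v)) S" using injh by (simp add: b_def)
  define B where "B = G\<lparr>arcs := b ` S\<rparr>"
  have B[simp]: "verts B = verts G" "arcs B = b ` S" "tail B = tail G" "head B = head G"
    by (simp_all add: B_def)
  have wfB: "wf_digraph B"
    using bG wf by (auto simp: wf_digraph_def)
  have spanB: "spanning B G"
    using wf wfB bG by (auto simp: spanning_def subgraph_def compatible_def)
  interpret M: pair_wf_digraph "mk_symmetric B"
    using wfB by (rule wf_digraph.wellformed_mk_symmetric)
  have adj: "(v, par v) \<in> parcs (mk_symmetric B)" if v: "v \<in> S" for v
  proof -
    have "(v, par v) \<in> {(tail G (b v), head G (b v)), (head G (b v), tail G (b v))}"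
      using bends[OF v] by (auto simp: doubleton_eq_iff)
    then show ?thesis unfolding parcs_mk_symmetric B using v by blast
  qed
  \<comment> \<open>Following \<open>par\<close> decreases the depth and so ends in
    \<open>r\<close>; each step uses the edge of \<open>b v\<close>, whichever way that arc
    points.\<close>
  have reach: "v \<rightarrow>\<^sup>*\<^bsub>with_proj (mk_symmetric B)\<^esub> r" if "v \<in> verts G" for v
    using that
  proof (induction "d v" arbitrary: v rule: less_induct)
    case less
    show ?case
    proof (cases "v = r")
      case False
      then have v: "v \<in> verts G - {r}" using less.prems by simp
      have "par v \<rightarrow>\<^sup>*\<^bsub>with_proj (mk_symmetric B)\<^esub> r"
        using less.hyps d[OF v] parV[OF v] by blast
      then show ?thesis
        using M.adj_reachable_trans[OF adj[of v]] v by (simp add: S_def)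
    qed (use less.prems in auto)
  qed
  have conB: "connected B"
    unfolding connected_def
  proof (rule strongly_connectedI)
    show "verts (with_proj (mk_symmetric B)) \<noteq> {}" using r by auto
    fix u v assume "u \<in> verts (with_proj (mk_symmetric B))" "v \<in> verts (with_proj (mk_symmetric B))"
    then show "u \<rightarrow>\<^sup>*\<^bsub>with_proj (mk_symmetric B)\<^esub> v"
      using reach[of u] symmetric_reachable[OF symmetric_mk_symmetric reach[of v]]
      by (auto intro: M.reachable_trans)
  qed
  let ?h = "\<lambda>v. head G (b v)"
  \<comment> \<open>The \<open>n - 1\<close> distinct heads miss exactly one vertex
    \<open>q\<close>. It is the root of \<open>B\<close> and may differ from the root
    \<open>r\<close> of \<open>A 1\<close>.\<close>
  have "card (?h ` S) = n - 1" using card_image[OF injb] cardS by simp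
  moreover have hV: "?h ` S \<subseteq> verts G" using bG wf by (auto simp: wf_digraph_def)
  ultimately have "card (verts G - ?h ` S) = 1"
    using card_Diff_subset[OF _ hV] finS assms(1,2) by simp
  then obtain q where q: "verts G - ?h ` S = {q}" by (auto simp: card_1_singleton_iff)
  have "in_degree B v = 1" if v: "v \<in> verts B - {q}" for v
  proof -
    obtain u where u: "u \<in> S" "v = ?h u" using q v by auto
    then have "in_arcs B v = {b u}" using injb by (auto simp: in_arcs_def inj_on_def)
    then show ?thesis by (simp add: in_degree_def)
  qed
  moreover have "q \<in> verts G" "q \<notin> ?h ` S" using q by blast+
  then have "q \<in> verts B" "in_arcs B q = {}" by auto
  ultimately have "arborescence B" using wfB conB unfolding arborescence_def by blast
  then have "spanning_arborescence B G" using spanB by (simp add: spanning_arborescence_def)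
  moreover have "rainbow ?I A B"
    unfolding rainbow_def
  proof
    fix i assume i: "i \<in> ?I"
    \<comment> \<open>By disjointness, the arc \<open>b v\<close> lies in no \<open>A i\<close>
      other than \<open>A (\<sigma> v)\<close>; as \<open>\<sigma>\<close> is injective, each index
      is used by only one arc of \<open>B\<close>.\<close>
    have "\<sigma> v = i" if "v \<in> S" "b v \<in> arcs (A i)" for v
      using that bA[OF that(1)] assms(4) \<sigma>[OF that(1)] i unfolding disjoint_family_on_def by blast
    then have "x = y" if "x \<in> arcs B \<inter> arcs (A i)" "y \<in> arcs B \<inter> arcs (A i)" for x y
      using that bij by (auto simp: bij_betw_def inj_on_def)
    then show "card (arcs B \<inter> arcs (A i)) \<le> 1"
      using finS by (simp add: card_le_Suc0_iff_eq)
  qed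
  ultimately show ?thesis by blast
qed

end
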